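(* Let $w$ be a positive integer, let $Y$ be a real random variable and $X=(X_1,\dots,X_w)$ a random vector in $\mathbb R^w$ with $$(Y,X)\sim\mathcal N\left(0,\begin{bmatrix} 1 & u^\top \\ {} u & I_w \end{bmatrix}\right),\qquad u=(u_1,\dots,u_w).$$ Then for any integers $\alpha,\beta_1,\dots,\beta_w\ge0$, $$\mathbb E\Big(h_\alpha(Y)\prod_{j=1}^wh_{\beta_j}(X_j)\Big)=\sqrt{\frac{\alpha!}{\prod_{j=1}^w\beta_j!}}\cdot\prod_{j=1}^wu_j^{\beta_j}\cdot 1\Big(\alpha=\sum_{j=1}^w\beta_j\Big),$$ where $1(\cdot)$ is the indicator function.
   Context: $h_k=\frac1{\sqrt{k!}}H_k$ are the normalized univariate Hermite polynomials, where $H_0(x)=1$, $H_1(x)=x$, $H_{k+1}(x)=xH_k(x)-kH_{k-1}(x)$ for $k\ge1$. The displayed covariance matrix is assumed positive semidefinite (equivalently $\|u\|_2\le1$), and $0^0=1$. *)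

theory Defs
  imports "HOL-Probability.Probability" "HOL-Computational_Algebra.Polynomial"
begin

fun hermite :: "nat \<Rightarrow> real poly" where
  "hermite 0 = 1"
| "hermite (Suc 0) = [:0, 1:]"
| "hermite (Suc (Suc k)) = [:0, 1:] * hermite (Suc k) - smult (of_nat (Suc k)) (hermite k)"

definition normalized_hermite :: "nat \<Rightarrow> real poly" where
  "normalized_hermite k = smult (1 / sqrt (fact k)) (hermite k)"

definition pos_semidef :: "real ^ 'n ^ 'n \<Rightarrow> bool" where
  "pos_semidef A \<longleftrightarrow> transpose A = A \<and> (\<forall>x. 0 \<le> x \<bullet> (A *v x))"

text \<open>The second parameter is the variance (the library's \<^const>\<open>normal_density\<close> takes the standard
  deviation); variance \<open>0\<close> gives the point mass at the mean.\<close>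

definition normal_law :: "real \<Rightarrow> real \<Rightarrow> real measure" where
  "normal_law m v =
     (if v = 0 then return borel m else density lborel (\<lambda>x. ennreal (normal_density m (sqrt v) x)))"

text \<open>A random vector has law $N(\mu, \Sigma)$ if each of its linear combinations $\langle t, Z\rangle$
  has the univariate normal law with mean $\langle t, \mu\rangle$ and variance
  $\langle t, \Sigma t\rangle$. Singular $\Sigma$ is allowed, so a joint density need not exist.\<close>

definition multivariate_normal ::
    "'a measure \<Rightarrow> ('a \<Rightarrow> real ^ 'n) \<Rightarrow> real ^ 'n \<Rightarrow> real ^ 'n ^ 'n \<Rightarrow> bool" where
  "multivariate_normal M Z \<mu> \<Sigma> \<longleftrightarrow>
     pos_semidef \<Sigma> \<and> Z \<in> borel_measurable M \<and>
     (\<forall>t. distr M borel (\<lambda>\<omega>. t \<bullet> Z \<omega>) = normal_law (t \<bullet> \<mu>) (t \<bullet> (\<Sigma> *v t)))"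

text \<open>Coordinates of $\mathbb{R}^{1+w}$ are indexed by \<^typ>\<open>'w option\<close>: \<^const>\<open>None\<close> is the
  leading scalar coordinate, \<open>Some j\<close> the \<open>j\<close>-th coordinate of the vector.\<close>

definition vec_cons :: "real \<Rightarrow> real ^ 'w \<Rightarrow> real ^ ('w::finite option)" where
  "vec_cons y x = (\<chi> i. case i of None \<Rightarrow> y | Some j \<Rightarrow> x $ j)"

definition block_cov :: "real ^ 'w \<Rightarrow> real ^ ('w::finite option) ^ ('w option)" where
  "block_cov u = (\<chi> i. case i of None \<Rightarrow> vec_cons 1 u | Some k \<Rightarrow> vec_cons (u $ k) (mat 1 $ k))"

end

theory Submission imports Defs begin

text \<open>A centred Gaussian vector \<open>Z\<close> with covariance \<open>K\<close> satisfies Stein's identity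
  \<open>E ((a \<bullet> Z) p(Z)) = E (p'(Z) (K a))\<close> for every polynomial \<open>p\<close> with derivative \<open>p'\<close>. Only the
  laws of the linear forms \<open>t \<bullet> Z\<close> are given, so the identity is obtained from the univariate moment
  recursion by polarization, that is, by differentiating in \<open>t\<close>. Together with
  \<open>H\<^sub>k\<^sub>+\<^sub>1 = x H\<^sub>k - k H\<^sub>k\<^sub>-\<^sub>1\<close> and \<open>H\<^sub>k' = k H\<^sub>k\<^sub>-\<^sub>1\<close> it expresses the expectation for
  \<open>(\<alpha> + 1, \<beta>)\<close> as the sum over \<open>j\<close> of \<open>u\<^sub>j \<beta>\<^sub>j\<close> times the one for \<open>(\<alpha>, \<beta> - e\<^sub>j)\<close>, and shows that it vanishes
  for \<open>\<alpha> = 0\<close>, \<open>\<beta> \<noteq> 0\<close>.\<close>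

section \<open>Moments of the univariate normal law\<close>

text \<open>For positive variance, odd moments vanish and the closed forms of two consecutive even
  moments are compared; for the point mass at 0 both sides are zero. The truncated exponent
  \<open>n - 1\<close> at \<open>n = 0\<close> is harmless because of the factor
  \<open>real n\<close>.\<close>

lemma normal_law_moments:
  assumes "v \<ge> 0"
  shows "integrable (normal_law 0 v) (\<lambda>x. x ^ n)"
    and "(\<integral>x. x ^ Suc n \<partial>normal_law 0 v) = real n * v * (\<integral>x. x ^ (n - 1) \<partial>normal_law 0 v)"
proof -
  have "integrable (normal_law 0 v) (\<lambda>x. x ^ n) \<and>
    (\<integral>x. x ^ Suc n \<partial>normal_law 0 v) = real n * v * (\<integral>x. x ^ (n - 1) \<partial>normal_law 0 v)"
  proof (cases "v = 0")
    case True
    interpret R: prob_space "return borel (0::real)"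
      by (rule prob_space_return) simp
    have "integrable (return borel (0::real)) (\<lambda>x. x ^ n)"
      by (rule R.integrable_const_bound[where B = 1]) (auto simp: AE_return power_0_left)
    with True show ?thesis
      by (simp add: normal_law_def integral_return)
  next
    case False
    define s where "s = sqrt v"
    have s: "s > 0" "s\<^sup>2 = v" using False assms by (auto simp: s_def)
    have mom: "(\<integral>x. x ^ k \<partial>normal_law 0 v) = (\<integral>x. normal_density 0 s x * (x - 0) ^ k \<partial>lborel)" for k
      using False by (simp add: normal_law_def integral_density s_def)
    have int: "integrable (normal_law 0 v) (\<lambda>x. x ^ n)"
      using integrable_normal_moment[OF s(1), of 0 n] False
      by (simp add: normal_law_def integrable_density s_def)
    have "(\<integral>x. x ^ Suc n \<partial>normal_law 0 v) = real n * v * (\<integral>x. x ^ (n - 1) \<partial>normal_law 0 v)"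
    proof (cases "even n")
      case True
      then obtain k where k: "n = 2 * k" by (elim evenE)
      have "n = 0 \<or> n - 1 = 2 * (k - 1) + 1" using k by auto
      then show ?thesis
        using integral_normal_moment_odd[OF s(1), of 0 k]
          integral_normal_moment_odd[OF s(1), of 0 "k - 1"] k unfolding mom by auto
    next
      case odd: False
      then obtain k where k: "n = 2 * k + 1" by (elim oddE)
      have e: "Suc n = 2 * Suc k" "n - 1 = 2 * k" using k by auto
      \<comment> \<open>The left side is the closed form of the moment of order
        \<open>2 * Suc k\<close>. Beyond the moment of order \<open>2 * k\<close> it contains
        (2k+2)(2k+1) / ((2/v)(k+1)), which equals (2k+1) v = n v.\<close>
      have "fact (2 * Suc k) / ((2 / v) ^ Suc k * fact (Suc k)) =
          (2 * real (Suc k) * real n * fact (2 * k)) / ((2 / v) * (2 / v) ^ k * (real (Suc k) * fact k))"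
        using k by (simp add: algebra_simps)
      also have "\<dots> = real n * v * (fact (2 * k) / ((2 / v) ^ k * fact k))"
        using False by (simp del: of_nat_Suc power_divide)
      finally show ?thesis
        unfolding e mom integral_normal_moment_even[OF s(1)] s(2) .
    qed
    with int show ?thesis by simp
  qed
  then show "integrable (normal_law 0 v) (\<lambda>x. x ^ n)"
    and "(\<integral>x. x ^ Suc n \<partial>normal_law 0 v) = real n * v * (\<integral>x. x ^ (n - 1) \<partial>normal_law 0 v)"
    by auto
qed

section \<open>Polynomials in a Gaussian vector and their integrability\<close>

text \<open>Riesz representation. Polynomial functions are generated from bounded linear
  functionals, while the Gaussian assumption speaks of inner products only.\<close>

lemma bounded_linear_real_inner:
  fixes f :: "'b::euclidean_space \<Rightarrow> real"
  assumes "bounded_linear f"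
  obtains t where "f = (\<lambda>z. t \<bullet> z)"
proof
  interpret f: bounded_linear f by fact
  show "f = (\<lambda>z. (\<Sum>b\<in>Basis. f b *\<^sub>R b) \<bullet> z)"
  proof
    fix z
    have "f z = f (\<Sum>b\<in>Basis. (z \<bullet> b) *\<^sub>R b)" by (simp add: euclidean_representation)
    also have "\<dots> = (\<Sum>b\<in>Basis. (z \<bullet> b) * f b)" by (simp add: f.sum f.scaleR)
    finally show "f z = (\<Sum>b\<in>Basis. f b *\<^sub>R b) \<bullet> z"
      unfolding inner_sum_left inner_scaleR_left by (simp add: inner_commute mult.commute)
  qed
qed

lemma real_polynomial_function_inner:
  "real_polynomial_function (\<lambda>z::'b::euclidean_space. t \<bullet> z)"
  by (rule real_polynomial_function.intros(1)) (rule bounded_linear_inner_right)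

lemmas polyfun_intros = real_polynomial_function.intros(2-4) real_polynomial_function_power
  real_polynomial_function_inner real_polynomial_function_sum real_polynomial_function_prod

text \<open>The covariance is an operator rather than a matrix, so that \<open>K a\<close> can serve
  directly as a direction of differentiation. Only one-dimensional laws are prescribed and no
  density is assumed, so a singular \<open>K\<close> is covered.\<close>

locale gaussian_vector = prob_space M for M :: "'a measure" +
  fixes Z :: "'a \<Rightarrow> 'b::euclidean_space" and K :: "'b \<Rightarrow> 'b"
  assumes measurable_Z [measurable]: "Z \<in> borel_measurable M"
    and linear_K: "linear K"
    and K_sym: "s \<bullet> K t = t \<bullet> K s"
    and K_nonneg: "0 \<le> t \<bullet> K t"
    and distr_inner: "distr M borel (\<lambda>\<omega>. t \<bullet> Z \<omega>) = normal_law 0 (t \<bullet> K t)"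
begin

definition E :: "('b \<Rightarrow> real) \<Rightarrow> real" where
  "E p = expectation (\<lambda>\<omega>. p (Z \<omega>))"

lemma integrable_inner_power: "integrable M (\<lambda>\<omega>. (t \<bullet> Z \<omega>) ^ n)"
  using normal_law_moments(1)[OF K_nonneg, of t n]
  unfolding distr_inner[symmetric] by (subst (asm) integrable_distr_eq) auto

lemma E_inner_power:
  "E (\<lambda>z. (t \<bullet> z) ^ Suc n) = real n * (t \<bullet> K t) * E (\<lambda>z. (t \<bullet> z) ^ (n - 1))"
proof -
  have "(\<integral>x. x ^ k \<partial>normal_law 0 (t \<bullet> K t)) = E (\<lambda>z. (t \<bullet> z) ^ k)" for k
    unfolding distr_inner[symmetric] E_def by (subst integral_distr) auto
  with normal_law_moments(2)[OF K_nonneg, of t n] show ?thesis by metis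
qed

lemma measurable_poly [measurable]:
  "real_polynomial_function p \<Longrightarrow> (\<lambda>\<omega>. p (Z \<omega>)) \<in> borel_measurable M"
  using measurable_compose[OF measurable_Z borel_measurable_continuous_onI[of p]]
  by (simp add: continuous_on_polymonial_function real_polynomial_function_eq)

text \<open>All powers are needed in the induction: the product case bounds the power
  \<open>n\<close> of a product by the powers \<open>2 * n\<close> of its factors
  (arithmetic-geometric mean), so integrability alone would not propagate.\<close>

lemma integrable_poly_abs_power:
  assumes "real_polynomial_function p"
  shows "integrable M (\<lambda>\<omega>. \<bar>p (Z \<omega>)\<bar> ^ n)"
  using assms
proof (induction p arbitrary: n rule: real_polynomial_function.induct)
  case (linear f)
  then obtain t where t: "f = (\<lambda>z. t \<bullet> z)" by (rule bounded_linear_real_inner)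
  then show ?case
    using integrable_abs[OF integrable_inner_power[of t n]]
    by (simp add: power_abs t)
next
  case (const c)
  show ?case by simp
next
  case (add f g)
  note [measurable] = measurable_poly[OF add(1)] measurable_poly[OF add(2)]
  have "\<bar>x + y\<bar> ^ n \<le> 2 ^ n * (\<bar>x\<bar> ^ n + \<bar>y\<bar> ^ n)" for x y :: real
  proof -
    have "\<bar>x + y\<bar> ^ n \<le> (2 * max \<bar>x\<bar> \<bar>y\<bar>) ^ n" by (rule power_mono) auto
    also have "\<dots> \<le> 2 ^ n * (\<bar>x\<bar> ^ n + \<bar>y\<bar> ^ n)"
      unfolding power_mult_distrib by (rule mult_left_mono) (auto simp: max_def)
    finally show ?thesis .
  qed
  moreover have "integrable M (\<lambda>\<omega>. 2 ^ n * (\<bar>f (Z \<omega>)\<bar> ^ n + \<bar>g (Z \<omega>)\<bar> ^ n))"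
    using add.IH by simp
  ultimately show ?case
    by (elim Bochner_Integration.integrable_bound) (auto intro!: AE_I2)
next
  case (mult f g)
  note [measurable] = measurable_poly[OF mult(1)] measurable_poly[OF mult(2)]
  have "\<bar>x * y\<bar> ^ n \<le> \<bar>x\<bar> ^ (2 * n) + \<bar>y\<bar> ^ (2 * n)" for x y :: real
  proof -
    have "2 * (\<bar>x\<bar> ^ n * \<bar>y\<bar> ^ n) \<le> (\<bar>x\<bar> ^ n)\<^sup>2 + (\<bar>y\<bar> ^ n)\<^sup>2"
      using sum_squares_bound[of "\<bar>x\<bar> ^ n" "\<bar>y\<bar> ^ n"] by simp
    moreover have "0 \<le> \<bar>x\<bar> ^ n * \<bar>y\<bar> ^ n" by simp
    ultimately have "\<bar>x\<bar> ^ n * \<bar>y\<bar> ^ n \<le> (\<bar>x\<bar> ^ n)\<^sup>2 + (\<bar>y\<bar> ^ n)\<^sup>2" by linarith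
    then show ?thesis by (simp add: abs_mult power_mult_distrib power_mult[symmetric] mult.commute)
  qed
  moreover have "integrable M (\<lambda>\<omega>. \<bar>f (Z \<omega>)\<bar> ^ (2 * n) + \<bar>g (Z \<omega>)\<bar> ^ (2 * n))"
    using mult.IH by simp
  ultimately show ?case
    by (elim Bochner_Integration.integrable_bound) (auto intro!: AE_I2)
qed

lemma integrable_poly:
  assumes "real_polynomial_function p"
  shows "integrable M (\<lambda>\<omega>. p (Z \<omega>))"
  using integrable_poly_abs_power[OF assms, of 1] measurable_poly[OF assms]
  by (simp add: integrable_abs_iff)

lemma E_add:
  "real_polynomial_function p \<Longrightarrow> real_polynomial_function q \<Longrightarrow>
    E (\<lambda>z. p z + q z) = E p + E q"
  by (simp add: E_def integrable_poly)

lemma E_diff: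
  "real_polynomial_function p \<Longrightarrow> real_polynomial_function q \<Longrightarrow>
    E (\<lambda>z. p z - q z) = E p - E q"
  by (simp add: E_def integrable_poly)

lemma E_sum:
  "(\<And>i. i \<in> I \<Longrightarrow> real_polynomial_function (p i)) \<Longrightarrow>
    E (\<lambda>z. \<Sum>i\<in>I. p i z) = (\<Sum>i\<in>I. E (p i))"
  by (simp add: E_def integrable_poly)

lemma E_cmult: "E (\<lambda>z. c * p z) = c * E p"
  by (simp add: E_def)

section \<open>Stein's identity by differentiation in the linear form\<close>

text \<open>The expectation is a polynomial in \<open>e\<close>, so no interchange of limit and
  integral is required. The induction peels off one factor, splits it as t \<bullet> z + e (b
  \<bullet> z), and lets the arbitrary polynomial \<open>f\<close> absorb either part.\<close>

lemma E_directional_derivative: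
  assumes "real_polynomial_function f"
  shows "((\<lambda>e. E (\<lambda>z. f z * ((t + e *\<^sub>R b) \<bullet> z) ^ n))
    has_real_derivative real n * E (\<lambda>z. f z * (t \<bullet> z) ^ (n - 1) * (b \<bullet> z))) (at 0)"
  using assms
proof (induction n arbitrary: f)
  case 0
  then show ?case by simp
next
  case (Suc n)
  have split: "E (\<lambda>z. f z * ((t + e *\<^sub>R b) \<bullet> z) ^ Suc n) =
      E (\<lambda>z. (f z * (t \<bullet> z)) * ((t + e *\<^sub>R b) \<bullet> z) ^ n) +
      e * E (\<lambda>z. (f z * (b \<bullet> z)) * ((t + e *\<^sub>R b) \<bullet> z) ^ n)" for e
  proof -
    have "(\<lambda>z. f z * ((t + e *\<^sub>R b) \<bullet> z) ^ Suc n) =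
       (\<lambda>z. f z * (t \<bullet> z) * ((t + e *\<^sub>R b) \<bullet> z) ^ n +
           e * ((f z * (b \<bullet> z)) * ((t + e *\<^sub>R b) \<bullet> z) ^ n))"
      by (simp add: fun_eq_iff inner_add_left algebra_simps)
    then show ?thesis
      using Suc.prems by (simp only:) (subst E_add, auto simp: E_cmult intro!: polyfun_intros)
  qed
  have p: "real_polynomial_function (\<lambda>z. f z * (t \<bullet> z))"
     "real_polynomial_function (\<lambda>z. f z * (b \<bullet> z))"
    using Suc.prems by (auto intro!: polyfun_intros)
  have eq: "(real n * E (\<lambda>z. f z * (t \<bullet> z) * (t \<bullet> z) ^ (n - 1) * (b \<bullet> z)) +
    E (\<lambda>z. f z * (b \<bullet> z) * (t \<bullet> z) ^ n)) = real (Suc n) * E (\<lambda>z. f z * (t \<bullet> z) ^ n * (b \<bullet> z))"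
    by (cases n) (simp_all add: ac_simps distrib_right distrib_left)
  show ?case unfolding split
    by (rule DERIV_cong[OF DERIV_add[OF Suc.IH[OF p(1)] DERIV_mult[OF DERIV_ident Suc.IH[OF p(2)]]]])
      (use eq in \<open>simp add: mult.commute\<close>)
qed

text \<open>Polarization of \<open>E_inner_power\<close>: its two sides are differentiated in
  \<open>t\<close> in the direction \<open>a\<close>, which yields a recursion from \<open>n\<close>
  to \<open>n - 2\<close>.\<close>

lemma E_inner_mult_power:
  "E (\<lambda>z. (t \<bullet> z) ^ n * (a \<bullet> z)) = real n * (t \<bullet> K a) * E (\<lambda>z. (t \<bullet> z) ^ (n - 1))"
proof (induction n rule: less_induct)
  case (less n)
  have p1: "real_polynomial_function (\<lambda>z::'b. 1)" by auto
  have quad: "(t + e *\<^sub>R a) \<bullet> K (t + e *\<^sub>R a) = t \<bullet> K t + e * (2 * (t \<bullet> K a)) + e * e * (a \<bullet> K a)" for e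
    using K_sym[of a t]
    by (simp add: linear_add[OF linear_K] linear_scale[OF linear_K] inner_add_left inner_add_right algebra_simps)
  have dv: "((\<lambda>e. t \<bullet> K t + e * (2 * (t \<bullet> K a)) + e * e * (a \<bullet> K a))
      has_real_derivative 2 * (t \<bullet> K a)) (at 0)"
    by (auto intro!: derivative_eq_intros)
  have L: "((\<lambda>e. E (\<lambda>z. ((t + e *\<^sub>R a) \<bullet> z) ^ Suc n)) has_real_derivative
       real (Suc n) * E (\<lambda>z. (t \<bullet> z) ^ n * (a \<bullet> z))) (at 0)"
    using E_directional_derivative[OF p1, of t a "Suc n"] by simp
  have R: "((\<lambda>e. E (\<lambda>z. ((t + e *\<^sub>R a) \<bullet> z) ^ (n - 1))) has_real_derivative
       real (n - 1) * E (\<lambda>z. (t \<bullet> z) ^ (n - 1 - 1) * (a \<bullet> z))) (at 0)"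
    using E_directional_derivative[OF p1, of t a "n - 1"] by simp
  have "real (Suc n) * E (\<lambda>z. (t \<bullet> z) ^ n * (a \<bullet> z)) =
     real n * (2 * (t \<bullet> K a) * E (\<lambda>z. (t \<bullet> z) ^ (n - 1)) +
       (t \<bullet> K t) * (real (n - 1) * E (\<lambda>z. (t \<bullet> z) ^ (n - 1 - 1) * (a \<bullet> z))))"
    using DERIV_cmult[OF DERIV_mult[OF dv R], of "real n"] L
    unfolding E_inner_power quad
    by (intro DERIV_unique[of _ _ 0]) (auto simp: algebra_simps)
  also have "\<dots> = real (Suc n) * (real n * (t \<bullet> K a) * E (\<lambda>z. (t \<bullet> z) ^ (n - 1)))"
  proof (cases "n < 2")
    case True
    then have "n = 0 \<or> n = 1" by auto
    then show ?thesis by auto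
  next
    case False
    then obtain m where m: "n = Suc (Suc m)"
      by (metis add_2_eq_Suc le_Suc_ex not_less)
    \<comment> \<open>By induction E ((t \<bullet> z)^m (a \<bullet> z)) = m (t \<bullet> K a) E ((t
      \<bullet> z)^(m-1)); multiplied by t \<bullet> K t, it becomes (t \<bullet> K a) E ((t
      \<bullet> z)^(m+1)) by the moment recursion. Hence the bracket holds 2 + (n-1) = n+1 copies of
      one term.\<close>
    show ?thesis
      using less.IH[of m] E_inner_power[of t m] unfolding m by (simp add: algebra_simps)
  qed
  finally show ?case by (simp del: of_nat_Suc)
qed

text \<open>The factor \<open>(t \<bullet> z) ^ n\<close> makes the predicate stable under multiplication of \<open>q\<close> by a
  linear form \<open>b \<bullet> z\<close>: differentiate the identity in \<open>t\<close> in the direction \<open>b\<close>.\<close>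

definition stein :: "('b \<Rightarrow> real) \<Rightarrow> bool" where
  "stein q \<longleftrightarrow> real_polynomial_function q \<and>
    (\<exists>q'. (\<forall>z. (q has_derivative q' z) (at z)) \<and> (\<forall>b. real_polynomial_function (\<lambda>z. q' z b)) \<and>
      (\<forall>a t n. E (\<lambda>z. (a \<bullet> z) * q z * (t \<bullet> z) ^ n) =
        E (\<lambda>z. q' z (K a) * (t \<bullet> z) ^ n) + real n * (t \<bullet> K a) * E (\<lambda>z. q z * (t \<bullet> z) ^ (n - 1))))"

lemma stein_one: "stein (\<lambda>z. 1)"
  unfolding stein_def
  by (intro conjI exI[of _ "\<lambda>z b. 0"] allI real_polynomial_function.intros(2))
    (use E_inner_mult_power E_cmult[of 0 "\<lambda>_. 0"] in \<open>auto simp: mult.commute\<close>)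

lemma stein_cmult:
  assumes "stein q"
  shows "stein (\<lambda>z. c * q z)"
proof -
  obtain q' where q: "real_polynomial_function q" "\<And>z. (q has_derivative q' z) (at z)"
     "\<And>b. real_polynomial_function (\<lambda>z. q' z b)"
     "\<And>a t n. E (\<lambda>z. (a \<bullet> z) * q z * (t \<bullet> z) ^ n) =
        E (\<lambda>z. q' z (K a) * (t \<bullet> z) ^ n) + real n * (t \<bullet> K a) * E (\<lambda>z. q z * (t \<bullet> z) ^ (n - 1))"
    using assms unfolding stein_def by blast
  have "E (\<lambda>z. (a \<bullet> z) * (c * q z) * (t \<bullet> z) ^ n) =
        E (\<lambda>z. (c * q' z (K a)) * (t \<bullet> z) ^ n) + real n * (t \<bullet> K a) * E (\<lambda>z. c * q z * (t \<bullet> z) ^ (n - 1))" for a t n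
    using q(4)[of a t n] E_cmult[of c "\<lambda>z. (a \<bullet> z) * q z * (t \<bullet> z) ^ n"]
     E_cmult[of c "\<lambda>z. q' z (K a) * (t \<bullet> z) ^ n"] E_cmult[of c "\<lambda>z. q z * (t \<bullet> z) ^ (n - 1)"]
    by (simp add: algebra_simps)
  then show ?thesis unfolding stein_def
    by (intro conjI exI[of _ "\<lambda>z b. c * q' z b"] allI)
      (use q in \<open>auto intro!: has_derivative_mult_right\<close>)
qed

lemma stein_add:
  assumes "stein p" "stein q"
  shows "stein (\<lambda>z. p z + q z)"
proof -
  obtain q' where q: "real_polynomial_function q" "\<And>z. (q has_derivative q' z) (at z)"
     "\<And>b. real_polynomial_function (\<lambda>z. q' z b)"
     "\<And>a t n. E (\<lambda>z. (a \<bullet> z) * q z * (t \<bullet> z) ^ n) =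
        E (\<lambda>z. q' z (K a) * (t \<bullet> z) ^ n) + real n * (t \<bullet> K a) * E (\<lambda>z. q z * (t \<bullet> z) ^ (n - 1))"
    using assms(2) unfolding stein_def by blast
  obtain p' where p: "real_polynomial_function p" "\<And>z. (p has_derivative p' z) (at z)"
     "\<And>b. real_polynomial_function (\<lambda>z. p' z b)"
     "\<And>a t n. E (\<lambda>z. (a \<bullet> z) * p z * (t \<bullet> z) ^ n) =
        E (\<lambda>z. p' z (K a) * (t \<bullet> z) ^ n) + real n * (t \<bullet> K a) * E (\<lambda>z. p z * (t \<bullet> z) ^ (n - 1))"
    using assms(1) unfolding stein_def by blast
  have "E (\<lambda>z. (a \<bullet> z) * (p z + q z) * (t \<bullet> z) ^ n) =
        E (\<lambda>z. (p' z (K a) + q' z (K a)) * (t \<bullet> z) ^ n) +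
        real n * (t \<bullet> K a) * E (\<lambda>z. (p z + q z) * (t \<bullet> z) ^ (n - 1))" for a t n
  proof -
    have 1: "E (\<lambda>z. (f z + g z) * (t \<bullet> z) ^ k) = E (\<lambda>z. f z * (t \<bullet> z) ^ k) + E (\<lambda>z. g z * (t \<bullet> z) ^ k)"
      if "real_polynomial_function f" "real_polynomial_function g" for f g k
      unfolding distrib_right by (rule E_add; intro polyfun_intros that)
    show ?thesis unfolding distrib_left
      by (subst (1 2 3) 1) (use p q in \<open>auto simp: algebra_simps intro!: polyfun_intros\<close>)
  qed
  then show ?thesis unfolding stein_def
    by (intro conjI exI[of _ "\<lambda>z b. p' z b + q' z b"] allI)
      (use p q in \<open>auto intro!: has_derivative_add\<close>)
qed

lemma stein_inner_mult:
  assumes "stein q"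
  shows "stein (\<lambda>z. (b \<bullet> z) * q z)"
proof -
  obtain q' where q: "real_polynomial_function q" "\<And>z. (q has_derivative q' z) (at z)"
     "\<And>b. real_polynomial_function (\<lambda>z. q' z b)"
     "\<And>a t n. E (\<lambda>z. (a \<bullet> z) * q z * (t \<bullet> z) ^ n) =
        E (\<lambda>z. q' z (K a) * (t \<bullet> z) ^ n) + real n * (t \<bullet> K a) * E (\<lambda>z. q z * (t \<bullet> z) ^ (n - 1))"
    using assms unfolding stein_def by blast
  have "E (\<lambda>z. (a \<bullet> z) * ((b \<bullet> z) * q z) * (t \<bullet> z) ^ n) =
        E (\<lambda>z. ((b \<bullet> z) * q' z (K a) + (b \<bullet> K a) * q z) * (t \<bullet> z) ^ n) +
        real n * (t \<bullet> K a) * E (\<lambda>z. (b \<bullet> z) * q z * (t \<bullet> z) ^ (n - 1))" for a t n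
  proof -
    have paq: "real_polynomial_function (\<lambda>z. (a \<bullet> z) * q z)" using q(1) by (intro polyfun_intros)
    \<comment> \<open>The hypothesis is taken at exponent \<open>Suc n\<close>, so that
      differentiation returns to exponent \<open>n\<close> with a common factor n+1 that cancels.
      Differentiating the coefficient t \<bullet> K a produces b \<bullet> K a, the new term that
      the product rule demands for the derivative of (b \<bullet> z) q along
      \<open>K a\<close>.\<close>
    have dv: "((\<lambda>e. real (Suc n) * ((t + e *\<^sub>R b) \<bullet> K a)) has_real_derivative real (Suc n) * (b \<bullet> K a)) (at 0)"
      unfolding inner_add_left inner_scaleR_left by (auto intro!: derivative_eq_intros)
    have L: "((\<lambda>e. E (\<lambda>z. (a \<bullet> z) * q z * ((t + e *\<^sub>R b) \<bullet> z) ^ Suc n)) has_real_derivative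
       real (Suc n) * E (\<lambda>z. (a \<bullet> z) * q z * (t \<bullet> z) ^ n * (b \<bullet> z))) (at 0)"
      using E_directional_derivative[OF paq, of t b "Suc n"] by simp
    have R1: "((\<lambda>e. E (\<lambda>z. q' z (K a) * ((t + e *\<^sub>R b) \<bullet> z) ^ Suc n)) has_real_derivative
       real (Suc n) * E (\<lambda>z. q' z (K a) * (t \<bullet> z) ^ n * (b \<bullet> z))) (at 0)"
      using E_directional_derivative[OF q(3), of "K a" t b "Suc n"] by simp
    have R2: "((\<lambda>e. E (\<lambda>z. q z * ((t + e *\<^sub>R b) \<bullet> z) ^ (Suc n - 1))) has_real_derivative
       real n * E (\<lambda>z. q z * (t \<bullet> z) ^ (n - 1) * (b \<bullet> z))) (at 0)"
      using E_directional_derivative[OF q(1), of t b n] by simp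
    have "real (Suc n) * E (\<lambda>z. (a \<bullet> z) * q z * (t \<bullet> z) ^ n * (b \<bullet> z)) =
       real (Suc n) * E (\<lambda>z. q' z (K a) * (t \<bullet> z) ^ n * (b \<bullet> z)) +
       (real (Suc n) * (b \<bullet> K a) * E (\<lambda>z. q z * ((t + 0 *\<^sub>R b) \<bullet> z) ^ (Suc n - 1)) +
        real n * E (\<lambda>z. q z * (t \<bullet> z) ^ (n - 1) * (b \<bullet> z)) * (real (Suc n) * ((t + 0 *\<^sub>R b) \<bullet> K a)))"
      using DERIV_unique[OF L[unfolded q(4)] DERIV_add[OF R1 DERIV_mult[OF dv R2]]] .
    also have "\<dots> = real (Suc n) * (E (\<lambda>z. q' z (K a) * (t \<bullet> z) ^ n * (b \<bullet> z)) +
       (b \<bullet> K a) * E (\<lambda>z. q z * (t \<bullet> z) ^ n) +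
        real n * (t \<bullet> K a) * E (\<lambda>z. q z * (t \<bullet> z) ^ (n - 1) * (b \<bullet> z)))"
      by (simp add: algebra_simps)
    finally have main: "E (\<lambda>z. (a \<bullet> z) * q z * (t \<bullet> z) ^ n * (b \<bullet> z)) =
       E (\<lambda>z. q' z (K a) * (t \<bullet> z) ^ n * (b \<bullet> z)) +
       (b \<bullet> K a) * E (\<lambda>z. q z * (t \<bullet> z) ^ n) +
        real n * (t \<bullet> K a) * E (\<lambda>z. q z * (t \<bullet> z) ^ (n - 1) * (b \<bullet> z))"
      by (simp del: of_nat_Suc)
    have "E (\<lambda>z. ((b \<bullet> z) * q' z (K a) + (b \<bullet> K a) * q z) * (t \<bullet> z) ^ n) =
      E (\<lambda>z. q' z (K a) * (t \<bullet> z) ^ n * (b \<bullet> z)) + E (\<lambda>z. (b \<bullet> K a) * (q z * (t \<bullet> z) ^ n))"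
      by (subst E_add[symmetric]) (use q(1,3) in \<open>auto simp: algebra_simps intro!: polyfun_intros\<close>)
    then have "E (\<lambda>z. ((b \<bullet> z) * q' z (K a) + (b \<bullet> K a) * q z) * (t \<bullet> z) ^ n) =
      E (\<lambda>z. q' z (K a) * (t \<bullet> z) ^ n * (b \<bullet> z)) + (b \<bullet> K a) * E (\<lambda>z. q z * (t \<bullet> z) ^ n)"
      unfolding E_cmult .
    with main show ?thesis by (simp add: ac_simps)
  qed
  moreover have "((\<lambda>z. (b \<bullet> z) * q z) has_derivative (\<lambda>d. (b \<bullet> z) * q' z d + (b \<bullet> d) * q z)) (at z)" for z
    by (intro has_derivative_mult q(2) has_derivative_inner_right has_derivative_ident)
  ultimately show ?thesis unfolding stein_def
    by (intro conjI exI[of _ "\<lambda>z d. (b \<bullet> z) * q' z d + (b \<bullet> d) * q z"] allI) (use q in \<open>auto intro!: polyfun_intros\<close>)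
qed

text \<open>With \<open>q\<close> arbitrary the induction concerns multiplication operators:
  multiplying by \<open>f * g\<close> is multiplying by \<open>g\<close> and then by
  \<open>f\<close>, so only linear forms, constants and sums need an argument.\<close>

lemma stein_poly_mult:
  "real_polynomial_function p \<Longrightarrow> stein q \<Longrightarrow> stein (\<lambda>z. p z * q z)"
proof (induction p arbitrary: q rule: real_polynomial_function.induct)
  case (linear f)
  then obtain t where "f = (\<lambda>z. t \<bullet> z)" using bounded_linear_real_inner by blast
  with stein_inner_mult[OF linear(2)] show ?case by simp
next
  case (const c)
  then show ?case by (rule stein_cmult)
next
  case (add f g)
  then show ?case using stein_add[of "\<lambda>z. f z * q z" "\<lambda>z. g z * q z"] by (simp add: distrib_right)
next
  case (mult f g)
  then show ?case by (simp add: mult.assoc)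
qed

theorem stein_identity:
  assumes "real_polynomial_function p" "\<And>z. (p has_derivative p' z) (at z)"
  shows "E (\<lambda>z. (a \<bullet> z) * p z) = E (\<lambda>z. p' z (K a))"
proof -
  obtain q' where q: "\<And>z. (p has_derivative q' z) (at z)"
     "\<And>a t n. E (\<lambda>z. (a \<bullet> z) * p z * (t \<bullet> z) ^ n) =
        E (\<lambda>z. q' z (K a) * (t \<bullet> z) ^ n) + real n * (t \<bullet> K a) * E (\<lambda>z. p z * (t \<bullet> z) ^ (n - 1))"
    using stein_poly_mult[OF assms(1) stein_one] unfolding stein_def by auto
  \<comment> \<open>The derivative inside \<open>stein\<close> is existentially quantified;
    uniqueness of the Frechet derivative identifies it with the given one. The choice
    \<open>n = 0\<close> then removes the power and the correction term.\<close>
  have "q' = p'"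
    using has_derivative_unique[OF q(1) assms(2)] by (simp add: fun_eq_iff)
  with q(2)[of a 0 0] show ?thesis by simp
qed

end

section \<open>Hermite polynomials and the derivative of their products\<close>

text \<open>Extends the three-term recurrence to \<open>k = 0\<close>, where the coefficient cancels
  the truncated index.\<close>

lemma poly_hermite_Suc:
  "poly (hermite (Suc k)) x = x * poly (hermite k) x - real k * poly (hermite (k - 1)) x"
  by (cases k) auto

lemma pderiv_hermite: "pderiv (hermite k) = smult (of_nat k) (hermite (k - 1))"
proof (induction k rule: hermite.induct)
  case (3 k)
  \<comment> \<open>Both induction hypotheses give H_{k+1} + (k+1) (x H_k - k H_{k-1}), and the
    bracket is again H_{k+1}.\<close>
  have "poly (pderiv (hermite (Suc (Suc k)))) x = real (Suc (Suc k)) * poly (hermite (Suc k)) x" for x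
    using 3 poly_hermite_Suc[of k x]
    by (simp del: hermite.simps add: hermite.simps(3) pderiv_diff pderiv_mult pderiv_smult pderiv_pCons)
      (simp add: algebra_simps)
  then show ?case by (intro poly_eqI_degree_lead_coeff poly_ext) auto
qed (auto simp: pderiv_pCons)

text \<open>Left unnormalized to keep square roots out of the recursions; the constant is restored
  in the final theorem.\<close>

definition hermite_prod :: "nat \<Rightarrow> ('w::finite \<Rightarrow> nat) \<Rightarrow> real ^ 'w option \<Rightarrow> real" where
  "hermite_prod \<alpha> \<beta> z = poly (hermite \<alpha>) (z $ None) * (\<Prod>j\<in>UNIV. poly (hermite (\<beta> j)) (z $ Some j))"

lemma has_derivative_hermite_component:
  "((\<lambda>z::real^'n. poly (hermite k) (z $ i)) has_derivative
     (\<lambda>d. real k * poly (hermite (k - 1)) (z $ i) * d $ i)) (at z)"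
proof -
  have "((\<lambda>z::real^'n. z $ i) has_derivative (\<lambda>d. d $ i)) (at z)"
    by (rule bounded_linear_imp_has_derivative) (rule bounded_linear_vec_nth)
  moreover have "(poly (hermite k) has_derivative (*) (real k * poly (hermite (k - 1)) (z $ i))) (at (z $ i))"
    using poly_DERIV[of "hermite k" "z $ i"]
    by (simp add: has_field_derivative_def pderiv_hermite)
  ultimately show ?thesis
    by (rule has_derivative_compose)
qed

text \<open>Index and exponent are separate arguments of \<open>g\<close>, so the lemma serves both
  the Hermite factors and the powers of the \<open>u $ j\<close>.\<close>

lemma prod_fun_upd_UNIV:
  fixes g :: "'w::finite \<Rightarrow> nat \<Rightarrow> 'c::comm_monoid_mult"
  shows "(\<Prod>i\<in>UNIV. g i ((\<beta>(j := m)) i)) = g j m * (\<Prod>i\<in>UNIV - {j}. g i (\<beta> i))"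
  by (subst prod.remove[of _ j]) (auto intro!: prod.cong)

text \<open>Product rule and \<open>pderiv_hermite\<close>. The partial derivatives are written as
  \<open>hermite_prod\<close> with one index lowered, so that Stein's identity becomes a recursion
  among expectations of such products.\<close>

lemma has_derivative_hermite_prod:
  "(hermite_prod \<alpha> \<beta> has_derivative (\<lambda>d. d $ None * (real \<alpha> * hermite_prod (\<alpha> - 1) \<beta> z) +
     (\<Sum>j\<in>UNIV. d $ Some j * (real (\<beta> j) * hermite_prod \<alpha> (\<beta>(j := \<beta> j - 1)) z)))) (at z)"
proof -
  have "(hermite_prod \<alpha> \<beta> has_derivative (\<lambda>d. poly (hermite \<alpha>) (z $ None) *
      (\<Sum>j\<in>UNIV. (real (\<beta> j) * poly (hermite (\<beta> j - 1)) (z $ Some j) * d $ Some j) *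
          (\<Prod>i\<in>UNIV - {j}. poly (hermite (\<beta> i)) (z $ Some i))) +
      (real \<alpha> * poly (hermite (\<alpha> - 1)) (z $ None) * d $ None) *
        (\<Prod>j\<in>UNIV. poly (hermite (\<beta> j)) (z $ Some j)))) (at z)"
    unfolding hermite_prod_def[abs_def]
    by (intro has_derivative_mult has_derivative_prod has_derivative_hermite_component)
  then show ?thesis
    unfolding hermite_prod_def prod_fun_upd_UNIV[of "\<lambda>i k. poly (hermite k) (z $ Some i)"]
    by (elim back_subst[of "\<lambda>d. (_ has_derivative d) _"])
      (simp add: fun_eq_iff sum_distrib_left algebra_simps)
qed

lemma real_polynomial_function_hermite_prod: "real_polynomial_function (hermite_prod \<alpha> \<beta>)"
proof -
  have "real_polynomial_function (\<lambda>z::real^'n. poly p (z $ i))" for p and i :: "'n::finite"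
    unfolding poly_altdef
    by (intro polyfun_intros real_polynomial_function.intros(1) bounded_linear_vec_nth finite_atMost)
  then show ?thesis
    unfolding hermite_prod_def[abs_def] by (intro polyfun_intros) auto
qed

section \<open>Recursion for the expectations under the block covariance\<close>

locale block_gaussian = gaussian_vector M Z "\<lambda>t. block_cov u *v t"
  for M :: "'a measure" and Z :: "'a \<Rightarrow> real ^ ('w::finite option)" and u :: "real ^ 'w"
begin

text \<open>Stein's identity with \<open>a\<close> the \<open>i\<close>-th unit vector:
  \<open>K a\<close> is column \<open>i\<close> of the covariance, whose entries weight the partial
  derivatives.\<close>

lemma stein_hermite_prod:
  "E (\<lambda>z. z $ i * hermite_prod \<alpha> \<beta> z) =
     block_cov u $ None $ i * (real \<alpha> * E (hermite_prod (\<alpha> - 1) \<beta>)) +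
     (\<Sum>j\<in>UNIV. block_cov u $ Some j $ i * (real (\<beta> j) * E (hermite_prod \<alpha> (\<beta>(j := \<beta> j - 1)))))"
proof -
  have "E (\<lambda>z. z $ i * hermite_prod \<alpha> \<beta> z) = E (\<lambda>z. (axis i 1 \<bullet> z) * hermite_prod \<alpha> \<beta> z)"
    by (simp add: inner_axis')
  also have "\<dots> = E (\<lambda>z. block_cov u $ None $ i * (real \<alpha> * hermite_prod (\<alpha> - 1) \<beta> z) +
     (\<Sum>j\<in>UNIV. block_cov u $ Some j $ i * (real (\<beta> j) * hermite_prod \<alpha> (\<beta>(j := \<beta> j - 1)) z)))"
    unfolding stein_identity[OF real_polynomial_function_hermite_prod has_derivative_hermite_prod]
    by (simp add: matrix_vector_mult_basis column_def)
  also have "\<dots> = block_cov u $ None $ i * (real \<alpha> * E (hermite_prod (\<alpha> - 1) \<beta>)) +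
     (\<Sum>j\<in>UNIV. block_cov u $ Some j $ i * (real (\<beta> j) * E (hermite_prod \<alpha> (\<beta>(j := \<beta> j - 1)))))"
    by (subst E_add E_sum; (intro polyfun_intros real_polynomial_function_hermite_prod finite)?)+
      (simp add: E_cmult)
  finally show ?thesis .
qed

text \<open>In the coordinate \<open>None\<close> the variance 1 produces exactly the term that the
  Hermite recurrence subtracts; only the covariances \<open>u $ j\<close> survive.\<close>

lemma E_hermite_prod_Suc:
  "E (hermite_prod (Suc \<alpha>) \<beta>) =
     (\<Sum>j\<in>UNIV. u $ j * (real (\<beta> j) * E (hermite_prod \<alpha> (\<beta>(j := \<beta> j - 1)))))"
proof -
  have "hermite_prod (Suc \<alpha>) \<beta> = (\<lambda>z. z $ None * hermite_prod \<alpha> \<beta> z - real \<alpha> * hermite_prod (\<alpha> - 1) \<beta> z)"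
    unfolding hermite_prod_def poly_hermite_Suc by (simp add: fun_eq_iff algebra_simps)
  then have "E (hermite_prod (Suc \<alpha>) \<beta>) =
      E (\<lambda>z. z $ None * hermite_prod \<alpha> \<beta> z) - real \<alpha> * E (hermite_prod (\<alpha> - 1) \<beta>)"
    by (simp only: E_cmult[symmetric]) (intro E_diff polyfun_intros real_polynomial_function.intros(1)
      bounded_linear_vec_nth real_polynomial_function_hermite_prod)
  then show ?thesis
    by (simp add: stein_hermite_prod block_cov_def vec_cons_def)
qed

text \<open>The same cancellation in the coordinate \<open>Some j\<close>: the identity block leaves
  only the index \<open>j\<close>, and the contribution of \<open>None\<close> carries the factor
  \<alpha> = 0.\<close>

lemma E_hermite_prod_0_Suc:
  assumes "\<beta> j = Suc m"
  shows "E (hermite_prod 0 \<beta>) = 0"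
proof -
  define \<gamma> where "\<gamma> = \<beta>(j := m)"
  have \<beta>: "\<beta> = \<gamma>(j := Suc m)" using assms by (auto simp: \<gamma>_def)
  \<comment> \<open>Written as an update so that the products with entry m+1, m and m-1 at
    \<open>j\<close> are instances of one formula.\<close>
  have \<gamma>: "\<gamma> = \<gamma>(j := m)" by (auto simp: \<gamma>_def)
  have "hermite_prod 0 \<beta> z = z $ Some j * hermite_prod 0 \<gamma> z - real m * hermite_prod 0 (\<gamma>(j := m - 1)) z" for z
  proof -
    let ?g = "\<lambda>i k. poly (hermite k) (z $ Some i)"
    have "hermite_prod 0 (\<gamma>(j := k)) z = ?g j k * (\<Prod>i\<in>UNIV - {j}. ?g i (\<gamma> i))" for k
      unfolding hermite_prod_def prod_fun_upd_UNIV[of ?g] by simp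
    from this[of "Suc m"] this[of m] this[of "m - 1"] show ?thesis
      unfolding \<beta>[symmetric] \<gamma>[symmetric] poly_hermite_Suc by (simp add: algebra_simps)
  qed
  then have "E (hermite_prod 0 \<beta>) =
      E (\<lambda>z. z $ Some j * hermite_prod 0 \<gamma> z - real m * hermite_prod 0 (\<gamma>(j := m - 1)) z)"
    by presburger
  also have "\<dots> = E (\<lambda>z. z $ Some j * hermite_prod 0 \<gamma> z) - real m * E (hermite_prod 0 (\<gamma>(j := m - 1)))"
    by (simp only: E_cmult[symmetric]) (intro E_diff polyfun_intros real_polynomial_function.intros(1)
      bounded_linear_vec_nth real_polynomial_function_hermite_prod)
  also have "E (\<lambda>z. z $ Some j * hermite_prod 0 \<gamma> z) =
      (\<Sum>i\<in>UNIV. if i = j then real m * E (hermite_prod 0 (\<gamma>(j := m - 1))) else 0)"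
  proof -
    have "block_cov u $ Some i $ Some j * (real (\<gamma> i) * E (hermite_prod 0 (\<gamma>(i := \<gamma> i - 1)))) =
        (if i = j then real m * E (hermite_prod 0 (\<gamma>(j := m - 1))) else 0)" for i
      by (simp add: block_cov_def vec_cons_def mat_def \<gamma>_def)
    then show ?thesis
      by (simp only: stein_hermite_prod of_nat_0 mult_zero_left mult_zero_right add_0_left)
  qed
  finally show ?thesis by (simp add: fun_upd_def)
qed

lemma E_hermite_prod:
  "E (hermite_prod \<alpha> \<beta>) = fact \<alpha> * (\<Prod>j\<in>UNIV. (u $ j) ^ \<beta> j) * of_bool (\<alpha> = (\<Sum>j\<in>UNIV. \<beta> j))"
proof (induction \<alpha> arbitrary: \<beta>)
  case 0
  show ?case
  proof (cases "\<exists>j. \<beta> j \<noteq> 0")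
    case True
    then obtain j m where "\<beta> j = Suc m" by (metis not0_implies_Suc)
    with True show ?thesis by (auto simp: E_hermite_prod_0_Suc)
  next
    case False
    then have "\<beta> = (\<lambda>_. 0)" by auto
    then show ?thesis by (simp add: hermite_prod_def[abs_def] E_def prob_space)
  qed
next
  case (Suc \<alpha>)
  let ?P = "\<Prod>j\<in>UNIV. (u $ j) ^ \<beta> j"
  \<comment> \<open>Lowering \<beta> at \<open>j\<close> lowers the total degree by one, which
    matches the indicator, and the factor \<open>u $ j\<close> completes the monomial; for
    \<open>\<beta> j = 0\<close> both sides vanish. Each summand is thus \<open>\<beta> j\<close>
    times one common value, and the weights add up to \<alpha> + 1 when the indicator is 1, turning
    \<alpha>! into (\<alpha>+1)!.\<close>
  have "u $ j * (real (\<beta> j) * E (hermite_prod \<alpha> (\<beta>(j := \<beta> j - 1)))) =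
      real (\<beta> j) * (fact \<alpha> * ?P * of_bool (Suc \<alpha> = (\<Sum>j\<in>UNIV. \<beta> j)))" for j
  proof (cases "\<beta> j")
    case (Suc m)
    have "(\<Sum>i\<in>UNIV. (\<beta>(j := m)) i) = m + (\<Sum>i\<in>UNIV - {j}. \<beta> i)"
      by (subst sum.remove[of _ j]) (auto intro!: sum.cong)
    moreover have "(\<Sum>i\<in>UNIV. \<beta> i) = Suc m + (\<Sum>i\<in>UNIV - {j}. \<beta> i)"
      by (subst sum.remove[of _ j]) (auto simp: Suc)
    moreover have "?P = u $ j * (\<Prod>i\<in>UNIV. (u $ i) ^ (\<beta>(j := m)) i)"
      unfolding prod_fun_upd_UNIV[of "\<lambda>i k. (u $ i) ^ k"]
      by (subst prod.remove[of _ j]) (auto simp: Suc)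
    ultimately show ?thesis
      unfolding Suc.IH Suc by simp
  qed simp
  then have "E (hermite_prod (Suc \<alpha>) \<beta>) =
      real (\<Sum>j\<in>UNIV. \<beta> j) * (fact \<alpha> * ?P * of_bool (Suc \<alpha> = (\<Sum>j\<in>UNIV. \<beta> j)))"
    by (simp only: E_hermite_prod_Suc sum_distrib_right of_nat_sum)
  then show ?case
    unfolding fact_Suc by (cases "Suc \<alpha> = (\<Sum>j\<in>UNIV. \<beta> j)") simp_all
qed

end

section \<open>Normalization and the final formula\<close>

theorem lemma4:
  fixes M :: "'a measure"
    and Y :: "'a \<Rightarrow> real"
    and X :: "'a \<Rightarrow> real ^ 'w"
    and u :: "real ^ 'w"
    and \<alpha> :: nat
    and \<beta> :: "'w::finite \<Rightarrow> nat"
  assumes "prob_space M"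
    and "Y \<in> borel_measurable M"
    and "X \<in> borel_measurable M"
    and "pos_semidef (block_cov u)"
    and "multivariate_normal M (\<lambda>\<omega>. vec_cons (Y \<omega>) (X \<omega>)) 0 (block_cov u)"
  shows "integrable M (\<lambda>\<omega>. poly (normalized_hermite \<alpha>) (Y \<omega>) *
             (\<Prod>j\<in>UNIV. poly (normalized_hermite (\<beta> j)) (X \<omega> $ j)))
       \<and> prob_space.expectation M (\<lambda>\<omega>. poly (normalized_hermite \<alpha>) (Y \<omega>) *
             (\<Prod>j\<in>UNIV. poly (normalized_hermite (\<beta> j)) (X \<omega> $ j)))
         = sqrt (fact \<alpha> / (\<Prod>j\<in>UNIV. fact (\<beta> j))) * (\<Prod>j\<in>UNIV. (u $ j) ^ \<beta> j)
             * of_bool (\<alpha> = (\<Sum>j\<in>UNIV. \<beta> j))"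
proof -
  interpret prob_space M by fact
  define Z where "Z = (\<lambda>\<omega>. vec_cons (Y \<omega>) (X \<omega>))"
  have mvn: "multivariate_normal M Z 0 (block_cov u)"
    using assms(5) by (simp add: Z_def)
  interpret block_gaussian M Z u
  proof
    fix s t :: "real ^ 'w option"
    show "Z \<in> borel_measurable M" "0 \<le> t \<bullet> (block_cov u *v t)"
      "distr M borel (\<lambda>\<omega>. t \<bullet> Z \<omega>) = normal_law 0 (t \<bullet> (block_cov u *v t))"
      using mvn by (auto simp: multivariate_normal_def pos_semidef_def)
    \<comment> \<open>Symmetry of the operator comes from the transpose condition in
      \<open>pos_semidef\<close>.\<close>
    show "s \<bullet> (block_cov u *v t) = t \<bullet> (block_cov u *v s)"
      using assms(4) unfolding pos_semidef_def
      by (metis dot_lmul_matrix inner_commute transpose_matrix_vector)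
  qed (auto simp: matrix_vector_right_distrib matrix_vector_mult_scaleR)
  define c where "c = 1 / sqrt (fact \<alpha>) * (\<Prod>j\<in>UNIV. 1 / sqrt (fact (\<beta> j)))"
  have eq: "poly (normalized_hermite \<alpha>) (Y \<omega>) *
      (\<Prod>j\<in>UNIV. poly (normalized_hermite (\<beta> j)) (X \<omega> $ j)) = c * hermite_prod \<alpha> \<beta> (Z \<omega>)" for \<omega>
    by (simp add: normalized_hermite_def hermite_prod_def Z_def vec_cons_def c_def prod_dividef)
  have sq: "sqrt (\<Prod>j\<in>UNIV. fact (\<beta> j)) = (\<Prod>j\<in>UNIV. sqrt (fact (\<beta> j)))"
    by (induction rule: infinite_finite_induct[of _ UNIV]) (simp_all add: real_sqrt_mult)
  \<comment> \<open>The factor \<alpha>! of the unnormalized expectation meets 1/sqrt(\<alpha>!) in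
    \<open>c\<close> and leaves sqrt(\<alpha>!) in the numerator.\<close>
  have c: "c * fact \<alpha> = sqrt (fact \<alpha> / (\<Prod>j\<in>UNIV. fact (\<beta> j)))"
  proof -
    have "fact \<alpha> / sqrt (fact \<alpha>) = sqrt (fact \<alpha>)"
      by (rule real_div_sqrt) simp
    then show ?thesis
      by (simp add: c_def real_sqrt_divide sq prod_dividef divide_divide_eq_left[symmetric]
          del: divide_divide_eq_left)
  qed
  have "integrable M (\<lambda>\<omega>. c * hermite_prod \<alpha> \<beta> (Z \<omega>))"
    by (intro integrable_mult_right integrable_poly real_polynomial_function_hermite_prod)
  moreover have "expectation (\<lambda>\<omega>. c * hermite_prod \<alpha> \<beta> (Z \<omega>)) =
      (c * fact \<alpha>) * (\<Prod>j\<in>UNIV. (u $ j) ^ \<beta> j) * of_bool (\<alpha> = (\<Sum>j\<in>UNIV. \<beta> j))"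
    using E_hermite_prod[of \<alpha> \<beta>] by (simp add: E_def)
  ultimately show ?thesis
    unfolding eq c by simp
qed

end
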